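(* Let $\beta>0$, $\tau=2\cosh(\beta)$ and $k=2$. Consider pairs $(a,b)$ of positive real numbers such that the $4$-periodic sequence $(u_n)_{n\in\mathbb Z}$ given by $$u_n=\begin{cases}1,& n\equiv0\text{ or }2\pmod4,\\ a,& n\equiv1\pmod 4,\\ b,& n\equiv 3\pmod 4,\end{cases}$$ satisfies $$u_i^2=\frac{u_{i-1}+u_{i+1}-\tau u_i}{u_{-1}+u_1-\tau},\qquad i\in\mathbb Z,$$ where the pairs $(a,b)$ and $(b,a)$ (which give the same sequence up to a cyclic shift) are regarded as the same solution. Put, whenever the square roots are real, $$a_{1}=\tfrac14\big(\tau-2-\sqrt{(\tau-2)^2-16}\big),\qquad a_2=\tfrac14\big(\tau-2+\sqrt{(\tau-2)^2-16}\big),$$ $$a_3=\frac{\tau-\sqrt{\tau^2-4\tau+4\sqrt{\tau^2-4\tau}}}{\tau-\sqrt{\tau^2-4\tau}},\qquad b_3=\frac{\tau+\sqrt{\tau^2-4\tau+4\sqrt{\tau^2-4\tau}}}{\tau-\sqrt{\tau^2-4\tau}},$$ $$a_5=\frac{\tau-\sqrt{\tau^2-4\tau-4\sqrt{\tau^2-4\tau}}}{\tau+\sqrt{\tau^2-4\tau}},\qquad b_5=\frac{\tau+\sqrt{\tau^2-4\tau-4\sqrt{\tau^2-4\tau}}}{\tau+\sqrt{\tau^2-4\tau}}.$$ Then: 1. If $\tau\le4$, there is a unique solution, $a=b=1$. 2. If $4<\tau\le6$, there are exactly two solutions: $a=b=1$ and $(a,b)=(a_3,b_3)$. 3. If $6<\tau<2+2\sqrt5$,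 there are exactly four solutions: $a=b=1$, $a=b=a_1$, $a=b=a_2$ and $(a,b)=(a_3,b_3)$. 4. If $\tau\ge2+2\sqrt5$, there are exactly five solutions: $a=b=1$, $a=b=a_1$, $a=b=a_2$, $(a,b)=(a_3,b_3)$ and $(a,b)=(a_5,b_5)$.
   Context: Since $\beta>0$, one has $\tau>2$. Satisfying the displayed equation includes the requirement that the denominator $u_{-1}+u_1-\tau$ is nonzero. (These sequences correspond to $4$-periodic boundary laws $z_i=u_i^2$ of the SOS model on the Cayley tree of order $2$, the infinite tree in which every vertex has exactly $3$ neighbours.)
   Formalization: In item 4 the count of exactly five is proved only for τ>2+2√5; at τ=2+2√5 one has a_5=b_5=a_1=(√5−1)/2, so the listed solutions (still the full set) are only four distinct ones, which is what is proved there. *)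

theory Defs
  imports Complex_Main "HOL-Library.Uprod"
begin

definition per_seq :: "real \<Rightarrow> real \<Rightarrow> int \<Rightarrow> real" where
  "per_seq a b n = (if n mod 4 = 1 then a else if n mod 4 = 3 then b else 1)"

text \<open>Since \<open>x / 0 = 0\<close> in HOL, the requirement that the denominator be nonzero is a separate conjunct.\<close>

definition boundary_law_eq :: "real \<Rightarrow> (int \<Rightarrow> real) \<Rightarrow> bool" where
  "boundary_law_eq \<tau> u \<longleftrightarrow>
     u (-1) + u 1 - \<tau> \<noteq> 0 \<and>
     (\<forall>i. (u i)\<^sup>2 = (u (i - 1) + u (i + 1) - \<tau> * u i) / (u (-1) + u 1 - \<tau>))"

text \<open>Unordered pairs identify the solutions \<open>(a, b)\<close> and \<open>(b, a)\<close>.\<close>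

definition solutions :: "real \<Rightarrow> real uprod set" where
  "solutions \<tau> = {Upair a b | a b. a > 0 \<and> b > 0 \<and> boundary_law_eq \<tau> (per_seq a b)}"

text \<open>
  The following expressions are used only for \<open>\<tau>\<close> such that all radicands are nonnegative:
  \<open>\<tau> \<ge> 6\<close> for \<open>a1\<close>, \<open>a2\<close>; \<open>\<tau> \<ge> 4\<close> for \<open>a3\<close>, \<open>b3\<close>; \<open>\<tau> \<ge> 2 + 2 * sqrt 5\<close> for \<open>a5\<close>, \<open>b5\<close>.
\<close>

definition a1 :: "real \<Rightarrow> real" where
  "a1 \<tau> = 1/4 * (\<tau> - 2 - sqrt ((\<tau> - 2)\<^sup>2 - 16))"

definition a2 :: "real \<Rightarrow> real" where
  "a2 \<tau> = 1/4 * (\<tau> - 2 + sqrt ((\<tau> - 2)\<^sup>2 - 16))"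

definition a3 :: "real \<Rightarrow> real" where
  "a3 \<tau> = (\<tau> - sqrt (\<tau>\<^sup>2 - 4 * \<tau> + 4 * sqrt (\<tau>\<^sup>2 - 4 * \<tau>))) / (\<tau> - sqrt (\<tau>\<^sup>2 - 4 * \<tau>))"

definition b3 :: "real \<Rightarrow> real" where
  "b3 \<tau> = (\<tau> + sqrt (\<tau>\<^sup>2 - 4 * \<tau> + 4 * sqrt (\<tau>\<^sup>2 - 4 * \<tau>))) / (\<tau> - sqrt (\<tau>\<^sup>2 - 4 * \<tau>))"

definition a5 :: "real \<Rightarrow> real" where
  "a5 \<tau> = (\<tau> - sqrt (\<tau>\<^sup>2 - 4 * \<tau> - 4 * sqrt (\<tau>\<^sup>2 - 4 * \<tau>))) / (\<tau> + sqrt (\<tau>\<^sup>2 - 4 * \<tau>))"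

definition b5 :: "real \<Rightarrow> real" where
  "b5 \<tau> = (\<tau> + sqrt (\<tau>\<^sup>2 - 4 * \<tau> - 4 * sqrt (\<tau>\<^sup>2 - 4 * \<tau>))) / (\<tau> + sqrt (\<tau>\<^sup>2 - 4 * \<tau>))"

end

theory Submission
  imports Defs
begin

text \<open>
  For \<open>\<tau> > 2\<close> the equation amounts to \<open>a\<^sup>2 (a + b - \<tau>) = 2 - \<tau> a\<close> and
  \<open>b\<^sup>2 (a + b - \<tau>) = 2 - \<tau> b\<close>; a zero denominator would force \<open>a = b = 2 / \<tau>\<close> and \<open>\<tau> = 2\<close>.
  Subtracting the two equations gives \<open>a = b\<close>, which leaves
  \<open>(a - 1) (2 a\<^sup>2 - (\<tau> - 2) a + 2) = 0\<close>, or \<open>S\<^sup>2 - \<tau> S + \<tau> = 0\<close> for \<open>S = a + b\<close>, and then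
  \<open>a b = 2 S / \<tau>\<close>. With \<open>t = \<plusminus>sqrt (\<tau>\<^sup>2 - 4 \<tau>)\<close> the latter reads \<open>S = 2 \<tau> / (\<tau> - t)\<close>,
  \<open>a b = 4 / (\<tau> - t)\<close>, which is solvable in the reals iff \<open>t\<^sup>2 + 4 t \<ge> 0\<close>.
\<close>

section \<open>Reduction of the periodic equation to polynomial equations in \<open>a\<close> and
  \<open>b\<close>\<close>

lemma boundary_law_eq_per_seq_iff:
  fixes a b \<tau> :: real
  assumes "\<tau> > 2"
  shows "boundary_law_eq \<tau> (per_seq a b) \<longleftrightarrow>
    a\<^sup>2 * (a + b - \<tau>) = 2 - \<tau> * a \<and> b\<^sup>2 * (a + b - \<tau>) = 2 - \<tau> * b"
    (is "?L \<longleftrightarrow> ?R")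
proof -
  have m: "per_seq a b (-1) = b" "per_seq a b 1 = a" by (simp_all add: per_seq_def)
  have step: "(per_seq a b i)\<^sup>2 =
      (per_seq a b (i - 1) + per_seq a b (i + 1) - \<tau> * per_seq a b i) / (b + a - \<tau>)"
    if nz: "b + a - \<tau> \<noteq> 0" and R: ?R for i
  proof -
    \<comment> \<open>At even indices \<open>u i = 1\<close> and the numerator equals the nonzero
      denominator, so the equation is automatic. Only the odd residues 1 and 3 constrain
      \<open>a\<close> and \<open>b\<close>.\<close>
    have "i mod 4 = 0 \<or> i mod 4 = 1 \<or> i mod 4 = 2 \<or> i mod 4 = 3" by presburger
    then consider "i mod 4 = 0" | "i mod 4 = 1" | "i mod 4 = 2" | "i mod 4 = 3" by blast
    then show ?thesis
    proof cases
      case 1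
      then have "(i - 1) mod 4 = 3" "(i + 1) mod 4 = 1" by presburger+
      with 1 nz show ?thesis by (simp add: per_seq_def)
    next
      case 2
      then have "(i - 1) mod 4 = 0" "(i + 1) mod 4 = 2" by presburger+
      with 2 nz R show ?thesis by (simp add: per_seq_def field_simps)
    next
      case 3
      then have "(i - 1) mod 4 = 1" "(i + 1) mod 4 = 3" by presburger+
      with 3 nz show ?thesis by (simp add: per_seq_def add.commute)
    next
      case 4
      then have "(i - 1) mod 4 = 2" "(i + 1) mod 4 = 0" by presburger+
      with 4 nz R show ?thesis by (simp add: per_seq_def field_simps)
    qed
  qed
  have "b + a - \<tau> \<noteq> 0" if R: ?R
  proof
    assume "b + a - \<tau> = 0"
    then have "a + b - \<tau> = 0" by simp
    with R have "\<tau> * a = 2" "\<tau> * b = 2" by auto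
    then have "\<tau> * (a + b) = 4" by (simp add: distrib_left)
    with \<open>a + b - \<tau> = 0\<close> have "\<tau> * \<tau> = 4" by simp
    moreover have "\<tau> * \<tau> > 2 * 2" using assms by (intro mult_strict_mono) auto
    ultimately show False by simp
  qed
  with step m have "?R \<Longrightarrow> ?L" unfolding boundary_law_eq_def by simp
  moreover have ?R if ?L
  proof -
    from that have nz: "b + a - \<tau> \<noteq> 0"
      and eq: "(per_seq a b i)\<^sup>2 =
        (per_seq a b (i - 1) + per_seq a b (i + 1) - \<tau> * per_seq a b i) / (b + a - \<tau>)" for i
      unfolding boundary_law_eq_def m by auto
    from eq[of 1] eq[of 3] have "a\<^sup>2 = (2 - \<tau> * a) / (b + a - \<tau>)" "b\<^sup>2 = (2 - \<tau> * b) / (b + a - \<tau>)"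
      by (simp_all add: per_seq_def)
    with nz show ?R by (simp add: add.commute)
  qed
  ultimately show ?thesis by blast
qed

text \<open>The two alternatives may overlap, as the second one does not demand
  \<open>a \<noteq> b\<close>. Putting \<open>a = b\<close> into it forces
  \<open>a = 4 / \<tau>\<close>, hence \<tau> = 4 or \<tau> = 2 + 2 sqrt 5, the values where the two
  families meet.\<close>

lemma system_iff:
  fixes a b \<tau> :: real
  assumes "\<tau> > 0"
  shows "a\<^sup>2 * (a + b - \<tau>) = 2 - \<tau> * a \<and> b\<^sup>2 * (a + b - \<tau>) = 2 - \<tau> * b \<longleftrightarrow>
    a = b \<and> (a = 1 \<or> 2 * a\<^sup>2 - (\<tau> - 2) * a + 2 = 0) \<or>
    (a + b)\<^sup>2 - \<tau> * (a + b) + \<tau> = 0 \<and> \<tau> * (a * b) = 2 * (a + b)"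
    (is "?L \<longleftrightarrow> ?D \<or> ?E")
proof -
  have diag: "?L \<longleftrightarrow> ?D" if "a = b"
  proof -
    have "a\<^sup>2 * (a + a - \<tau>) - (2 - \<tau> * a) = (a - 1) * (2 * a\<^sup>2 - (\<tau> - 2) * a + 2)"
      by (simp add: power2_eq_square algebra_simps)
    then have "a\<^sup>2 * (a + a - \<tau>) = 2 - \<tau> * a \<longleftrightarrow> (a - 1) * (2 * a\<^sup>2 - (\<tau> - 2) * a + 2) = 0"
      by linarith
    with that show ?thesis by simp
  qed
  \<comment> \<open>Both defects have the shape "variable times Q plus a common remainder", with Q
    the quadratic in \<open>a + b\<close>. Their difference is therefore \<open>(a - b)\<close>
    times Q, and both vanish once Q and the remainder do.\<close>
  have red: "a\<^sup>2 * (a + b - \<tau>) - (2 - \<tau> * a) =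
      a * ((a + b)\<^sup>2 - \<tau> * (a + b) + \<tau>) + (a * b * (\<tau> - (a + b)) - 2)"
    "b\<^sup>2 * (a + b - \<tau>) - (2 - \<tau> * b) =
      b * ((a + b)\<^sup>2 - \<tau> * (a + b) + \<tau>) + (a * b * (\<tau> - (a + b)) - 2)"
    by (simp_all add: power2_eq_square algebra_simps)
  have off: ?E if "a \<noteq> b" ?L
  proof -
    have "(a - b) * ((a + b)\<^sup>2 - \<tau> * (a + b) + \<tau>) =
        (a\<^sup>2 * (a + b - \<tau>) - (2 - \<tau> * a)) - (b\<^sup>2 * (a + b - \<tau>) - (2 - \<tau> * b))"
      unfolding red by (simp only: left_diff_distrib add_diff_cancel_right)
    also have "\<dots> = 0" using \<open>?L\<close> by simp
    finally have "(a - b) * ((a + b)\<^sup>2 - \<tau> * (a + b) + \<tau>) = 0" .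
    with \<open>a \<noteq> b\<close> have S: "(a + b)\<^sup>2 - \<tau> * (a + b) + \<tau> = 0" by simp
    from \<open>?L\<close> S red(1) have P: "a * b * (\<tau> - (a + b)) = 2" by simp
    \<comment> \<open>Read as \<open>\<tau> = S * (\<tau> - S)\<close> with
      \<open>S = a + b\<close>, the quadratic turns \<open>a * b * (\<tau> - S) = 2\<close> into the
      product condition without division.\<close>
    from S have "\<tau> = (a + b) * (\<tau> - (a + b))" by (simp add: power2_eq_square algebra_simps)
    then have "\<tau> * (a * b) = (a + b) * (a * b * (\<tau> - (a + b)))"
      by (metis mult.assoc mult.commute)
    with P S show ?thesis by (simp add: mult.commute)
  qed
  have ?L if ?E
  proof -
    \<comment> \<open>Multiplied by \<tau>, the common remainder becomes -2 times the quadratic in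
      \<open>a + b\<close>, so it vanishes too.\<close>
    have "\<tau> * (a * b * (\<tau> - (a + b)) - 2) = \<tau> * (a * b) * (\<tau> - (a + b)) - 2 * \<tau>"
      by (simp add: right_diff_distrib mult.assoc)
    also have "\<dots> = 2 * (a + b) * (\<tau> - (a + b)) - 2 * \<tau>" using that by simp
    also have "\<dots> = - 2 * ((a + b)\<^sup>2 - \<tau> * (a + b) + \<tau>)"
      by (simp add: power2_eq_square algebra_simps)
    finally have "\<tau> * (a * b * (\<tau> - (a + b)) - 2) = 0" using that by simp
    with assms have "a * b * (\<tau> - (a + b)) = 2" by simp
    with that red show ?L by simp
  qed
  with diag off show ?thesis by blast
qed

section \<open>Off-diagonal pairs described by sum and product\<close>

lemma Upair_eq_iff_sum_prod:
  fixes a b c d :: "'a :: idom"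
  shows "Upair a b = Upair c d \<longleftrightarrow> a + b = c + d \<and> a * b = c * d"
proof
  assume R: "a + b = c + d \<and> a * b = c * d"
  \<comment> \<open>By Vieta, both pairs are the roots of the same monic quadratic, and
    \<open>a\<close> is one of them.\<close>
  then have "(a - c) * (a - d) = 0" by algebra
  then have "a = c \<or> a = d" by simp
  with R show "Upair a b = Upair c d" by (auto simp: add.commute)
qed (auto simp: ac_simps)

text \<open>The parameter \<open>t\<close> is a signed square root of
  \<open>\<tau>\<^sup>2 - 4 * \<tau>\<close>. The nonnegative root leads to \<open>a3\<close>,
  \<open>b3\<close> and the nonpositive one to \<open>a5\<close>, \<open>b5\<close>, so both
  families are handled by the same lemmas.\<close>

definition branch_pairs :: "real \<Rightarrow> real \<Rightarrow> real uprod set" where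
  "branch_pairs \<tau> t =
    {Upair a b | a b. a > 0 \<and> b > 0 \<and> a + b = 2 * \<tau> / (\<tau> - t) \<and> a * b = 4 / (\<tau> - t)}"

text \<open>Keeps the denominator \<open>\<tau> - t\<close> positive for either sign of
  \<open>t\<close>.\<close>

lemma branch_less:
  fixes \<tau> t :: real
  assumes "\<tau> > 0" "t\<^sup>2 = \<tau>\<^sup>2 - 4 * \<tau>"
  shows "t < \<tau>"
  using assms power2_less_imp_less[of t \<tau>] by simp

text \<open>The discriminant \<open>(a - b)\<^sup>2\<close>, cleared of denominators by the factor
  \<open>(\<tau> - t)\<^sup>2\<close>, equals \<open>4 * (t\<^sup>2 + 4 * t)\<close>; a negative
  value excludes real \<open>a\<close> and \<open>b\<close>.\<close>

lemma branch_pairs_empty: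
  assumes "\<tau> > 0" "t\<^sup>2 = \<tau>\<^sup>2 - 4 * \<tau>" "t\<^sup>2 + 4 * t < 0"
  shows "branch_pairs \<tau> t = {}"
proof -
  have "t < \<tau>" by (rule branch_less) fact+
  have False if S: "a + b = 2 * \<tau> / (\<tau> - t)" and P: "a * b = 4 / (\<tau> - t)" for a b
  proof -
    have "((a - b) * (\<tau> - t))\<^sup>2 =
        ((a + b) * (\<tau> - t))\<^sup>2 - 4 * (a * b * (\<tau> - t)) * (\<tau> - t)"
      by (simp add: power2_eq_square algebra_simps)
    also have "(a + b) * (\<tau> - t) = 2 * \<tau>" using S \<open>t < \<tau>\<close> by (simp add: eq_divide_eq)
    also have "a * b * (\<tau> - t) = 4" using P \<open>t < \<tau>\<close> by (simp add: eq_divide_eq)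
    also have "(2 * \<tau>)\<^sup>2 - 4 * 4 * (\<tau> - t) = 4 * (t\<^sup>2 + 4 * t)"
      using assms(2) by (simp add: power_mult_distrib)
    finally have "((a - b) * (\<tau> - t))\<^sup>2 = 4 * (t\<^sup>2 + 4 * t)" .
    with assms(3) show False by (smt (verit) zero_le_power2)
  qed
  then show ?thesis unfolding branch_pairs_def by blast
qed

text \<open>Sum and product determine the unordered pair, so it suffices to exhibit one positive
  pair. Here \<open>r\<^sup>2 = \<tau>\<^sup>2 - 4 * (\<tau> - t)\<close>, which gives both
  \<open>r < \<tau>\<close>, hence positivity, and the product. The sum is recorded in order to tell
  the two branches apart later.\<close>

lemma branch_pairs_singleton:
  assumes "\<tau> > 0" and t: "t\<^sup>2 = \<tau>\<^sup>2 - 4 * \<tau>" and nn: "t\<^sup>2 + 4 * t \<ge> 0"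
  defines "r \<equiv> sqrt (\<tau>\<^sup>2 - 4 * \<tau> + 4 * t)"
  shows "branch_pairs \<tau> t = {Upair ((\<tau> - r) / (\<tau> - t)) ((\<tau> + r) / (\<tau> - t))}"
    and "(\<tau> - r) / (\<tau> - t) + (\<tau> + r) / (\<tau> - t) = 2 * \<tau> / (\<tau> - t)"
proof -
  have lt: "t < \<tau>" by (rule branch_less) fact+
  have r0: "r \<ge> 0" and r2: "r\<^sup>2 = \<tau>\<^sup>2 - 4 * \<tau> + 4 * t"
    using nn t by (auto simp: r_def)
  have "r\<^sup>2 < \<tau>\<^sup>2" using r2 lt by simp
  then have "r < \<tau>" using assms(1) power2_less_imp_less[of r \<tau>] by simp
  define a b where ab: "a = (\<tau> - r) / (\<tau> - t)" "b = (\<tau> + r) / (\<tau> - t)"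
  have pos: "a > 0" "b > 0" using ab lt r0 \<open>r < \<tau>\<close> assms(1) by (auto intro!: divide_pos_pos)
  have S: "a + b = 2 * \<tau> / (\<tau> - t)" unfolding ab by (simp flip: add_divide_distrib)
  have "(\<tau> - r) * (\<tau> + r) = 4 * (\<tau> - t)" using r2 by algebra
  then have "a * b = 4 * (\<tau> - t) / ((\<tau> - t) * (\<tau> - t))" 
    unfolding ab times_divide_times_eq by simp
  then have P: "a * b = 4 / (\<tau> - t)"
    using lt nonzero_mult_divide_mult_cancel_right[of "\<tau> - t" 4] by simp
  have "Upair x y = Upair a b \<longleftrightarrow> x + y = 2 * \<tau> / (\<tau> - t) \<and> x * y = 4 / (\<tau> - t)" for x y
    unfolding Upair_eq_iff_sum_prod S P ..
  with pos S P show "branch_pairs \<tau> t = {Upair a b}"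
    unfolding branch_pairs_def by blast
  show "a + b = 2 * \<tau> / (\<tau> - t)" by (fact S)
qed

text \<open>Since \<open>(\<tau> - s) * (\<tau> + s) = 4 * \<tau>\<close>, the roots
  \<open>(\<tau> + s) / 2\<close> and \<open>(\<tau> - s) / 2\<close> of the quadratic for the sum
  can be rewritten with denominators \<open>\<tau> - s\<close> and \<open>\<tau> + s\<close>;
  likewise for the products.\<close>

lemma off_diagonal_iff_branch:
  fixes a b s \<tau> :: real
  assumes "\<tau> > 0" and s: "s\<^sup>2 = \<tau>\<^sup>2 - 4 * \<tau>"
  shows "(a + b)\<^sup>2 - \<tau> * (a + b) + \<tau> = 0 \<and> \<tau> * (a * b) = 2 * (a + b) \<longleftrightarrow>
    (\<exists>t\<in>{s, -s}. a + b = 2 * \<tau> / (\<tau> - t) \<and> a * b = 4 / (\<tau> - t))"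
proof -
  have lt: "\<tau> - s > 0" "\<tau> + s > 0"
    using branch_less[OF assms] branch_less[of \<tau> "-s"] assms by auto
  have prod: "(\<tau> - s) * (\<tau> + s) = 4 * \<tau>" using s by algebra
  have inv: "2 * \<tau> / (\<tau> - s) = (\<tau> + s) / 2" "2 * \<tau> / (\<tau> + s) = (\<tau> - s) / 2"
    "4 / (\<tau> - s) = (\<tau> + s) / \<tau>" "4 / (\<tau> + s) = (\<tau> - s) / \<tau>"
    using lt prod assms(1) by (simp_all add: field_simps)
  have "(a + b)\<^sup>2 - \<tau> * (a + b) + \<tau> = (a + b - (\<tau> + s) / 2) * (a + b - (\<tau> - s) / 2)"
    using s by (simp add: power2_eq_square field_simps)
  then have "(a + b)\<^sup>2 - \<tau> * (a + b) + \<tau> = 0 \<longleftrightarrow> a + b = (\<tau> + s) / 2 \<or> a + b = (\<tau> - s) / 2"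
    by (simp only: mult_eq_0_iff right_minus_eq)
  moreover have "\<tau> * (a * b) = 2 * (a + b) \<longleftrightarrow> a * b = 2 * (a + b) / \<tau>"
    using assms(1) by (auto simp: field_simps)
  moreover have "a + b = (\<tau> + s) / 2 \<Longrightarrow> 2 * (a + b) / \<tau> = (\<tau> + s) / \<tau>"
    "a + b = (\<tau> - s) / 2 \<Longrightarrow> 2 * (a + b) / \<tau> = (\<tau> - s) / \<tau>" by simp_all
  ultimately have "(a + b)\<^sup>2 - \<tau> * (a + b) + \<tau> = 0 \<and> \<tau> * (a * b) = 2 * (a + b) \<longleftrightarrow>
    a + b = (\<tau> + s) / 2 \<and> a * b = (\<tau> + s) / \<tau> \<or> a + b = (\<tau> - s) / 2 \<and> a * b = (\<tau> - s) / \<tau>"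
    by metis
  then show ?thesis by (simp only: bex_simps inv minus_minus diff_minus_eq_add bex_empty simp_thms)
qed

section \<open>The diagonal solutions \<open>a = b\<close>\<close>

lemma diagonal_quadratic_iff:
  fixes a \<tau> :: real
  assumes "\<tau> \<ge> 6"
  shows "2 * a\<^sup>2 - (\<tau> - 2) * a + 2 = 0 \<longleftrightarrow> a = a1 \<tau> \<or> a = a2 \<tau>"
proof -
  define q where "q = sqrt ((\<tau> - 2)\<^sup>2 - 16)"
  have "4\<^sup>2 \<le> (\<tau> - 2)\<^sup>2" using assms by (intro power_mono) auto
  then have q: "q\<^sup>2 = (\<tau> - 2)\<^sup>2 - 16" by (simp add: q_def)
  then have "2 * a\<^sup>2 - (\<tau> - 2) * a + 2 =
      2 * ((a - 1/4 * (\<tau> - 2 - q)) * (a - 1/4 * (\<tau> - 2 + q)))"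
    by (simp add: power2_eq_square field_simps)
  then show ?thesis
    unfolding a1_def a2_def q_def[symmetric]
    by (simp only: mult_eq_0_iff right_minus_eq) simp
qed

lemma diagonal_quadratic_no_root:
  fixes a \<tau> :: real
  assumes "2 < \<tau>" "\<tau> < 6"
  shows "2 * a\<^sup>2 - (\<tau> - 2) * a + 2 \<noteq> 0"
proof
  assume "2 * a\<^sup>2 - (\<tau> - 2) * a + 2 = 0"
  then have "(4 * a - (\<tau> - 2))\<^sup>2 = (\<tau> - 2)\<^sup>2 - 4\<^sup>2" by algebra
  moreover have "(\<tau> - 2)\<^sup>2 < 4\<^sup>2" using assms by (intro power_strict_mono) auto
  ultimately show False by (smt (verit) zero_le_power2)
qed

lemma a1_a2:
  assumes "\<tau> > 6"
  shows "a1 \<tau> > 0" "a1 \<tau> < a2 \<tau>" "a1 \<tau> \<noteq> 1" "a2 \<tau> \<noteq> 1"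
proof -
  have "4\<^sup>2 < (\<tau> - 2)\<^sup>2" using assms by (intro power_strict_mono) auto
  then have "sqrt ((\<tau> - 2)\<^sup>2 - 16) > 0" by simp
  then show "a1 \<tau> < a2 \<tau>" by (simp add: a1_def a2_def)
  have "sqrt ((\<tau> - 2)\<^sup>2 - 16) < sqrt ((\<tau> - 2)\<^sup>2)" by (intro real_sqrt_less_mono) simp
  then show "a1 \<tau> > 0" using assms by (simp add: a1_def)
  \<comment> \<open>At 1 the quadratic takes the value \<open>6 - \<tau>\<close>, which is nonzero
    here.\<close>
  show "a1 \<tau> \<noteq> 1" "a2 \<tau> \<noteq> 1"
    using diagonal_quadratic_iff[of \<tau> 1] assms by auto
qed

definition diagonal_pairs :: "real \<Rightarrow> real uprod set" where
  "diagonal_pairs \<tau> = {Upair a a | a. a > 0 \<and> (a = 1 \<or> 2 * a\<^sup>2 - (\<tau> - 2) * a + 2 = 0)}"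

lemma diagonal_pairs_le_6:
  assumes "2 < \<tau>" "\<tau> \<le> 6"
  shows "diagonal_pairs \<tau> = {Upair 1 1}"
proof -
  \<comment> \<open>At \<tau> = 6 the quadratic is \<open>2 * (a - 1)\<^sup>2\<close>, so its double
    root adds nothing to the solution 1.\<close>
  have "a1 6 = 1" "a2 6 = 1" by (simp_all add: a1_def a2_def)
  then have "2 * a\<^sup>2 - (\<tau> - 2) * a + 2 = 0 \<Longrightarrow> a = 1" for a
    using diagonal_quadratic_iff[of \<tau> a] diagonal_quadratic_no_root[of \<tau> a] assms
    by (cases "\<tau> = 6") auto
  then show ?thesis unfolding diagonal_pairs_def by fastforce
qed

lemma diagonal_pairs_gt_6:
  assumes "\<tau> > 6"
  shows "diagonal_pairs \<tau> = {Upair 1 1, Upair (a1 \<tau>) (a1 \<tau>), Upair (a2 \<tau>) (a2 \<tau>)}"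
proof -
  have "2 * a\<^sup>2 - (\<tau> - 2) * a + 2 = 0 \<longleftrightarrow> a = a1 \<tau> \<or> a = a2 \<tau>" for a
    using diagonal_quadratic_iff assms by simp
  moreover have "a1 \<tau> > 0" "a2 \<tau> > 0" using a1_a2[OF assms] by auto
  ultimately show ?thesis unfolding diagonal_pairs_def by auto
qed

section \<open>Decomposition of the solution set into diagonal and branches\<close>

lemma solutions_eq_diagonal_union:
  assumes "\<tau> > 2"
  shows "solutions \<tau> = diagonal_pairs \<tau> \<union> {Upair a b | a b. a > 0 \<and> b > 0 \<and>
    (a + b)\<^sup>2 - \<tau> * (a + b) + \<tau> = 0 \<and> \<tau> * (a * b) = 2 * (a + b)}"
proof -
  have "boundary_law_eq \<tau> (per_seq a b) \<longleftrightarrow>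
    a = b \<and> (a = 1 \<or> 2 * a\<^sup>2 - (\<tau> - 2) * a + 2 = 0) \<or>
    (a + b)\<^sup>2 - \<tau> * (a + b) + \<tau> = 0 \<and> \<tau> * (a * b) = 2 * (a + b)" for a b
    using boundary_law_eq_per_seq_iff[OF assms] system_iff[of \<tau> a b] assms by simp
  then show ?thesis unfolding solutions_def diagonal_pairs_def by auto
qed

text \<open>The quadratic for the sum \<open>a + b\<close> has discriminant
  \<open>\<tau> * (\<tau> - 4)\<close>, which is negative here, so nothing but the diagonal
  remains.\<close>

lemma solutions_lt_4:
  assumes "2 < \<tau>" "\<tau> < 4"
  shows "solutions \<tau> = diagonal_pairs \<tau>"
proof -
  have False if "S\<^sup>2 - \<tau> * S + \<tau> = 0" for S
  proof -
    from that have "(2 * S - \<tau>)\<^sup>2 = \<tau> * (\<tau> - 4)" by algebra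
    moreover have "\<tau> * (\<tau> - 4) < 0" using assms by (intro mult_pos_neg) auto
    ultimately show False by (smt (verit) zero_le_power2)
  qed
  then show ?thesis using assms by (auto simp: solutions_eq_diagonal_union)
qed

lemma solutions_ge_4:
  assumes "\<tau> \<ge> 4"
  defines "s \<equiv> sqrt (\<tau>\<^sup>2 - 4 * \<tau>)"
  shows "solutions \<tau> = diagonal_pairs \<tau> \<union> branch_pairs \<tau> s \<union> branch_pairs \<tau> (- s)"
proof -
  have "\<tau>\<^sup>2 - 4 * \<tau> \<ge> 0" using assms by (simp add: power2_eq_square)
  then have s: "s\<^sup>2 = \<tau>\<^sup>2 - 4 * \<tau>" by (simp add: s_def)
  have "\<tau> > 0" "\<tau> > 2" using assms by auto
  show ?thesis
    unfolding solutions_eq_diagonal_union[OF \<open>\<tau> > 2\<close>] off_diagonal_iff_branch[OF \<open>\<tau> > 0\<close> s]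
      branch_pairs_def by blast
qed

section \<open>The four ranges of \<tau> and the number of solutions\<close>

theorem proposition2:
  fixes \<beta> \<tau> :: real
  assumes "\<beta> > 0" and "\<tau> = 2 * cosh \<beta>"
  shows
    "(\<tau> \<le> 4 \<longrightarrow>
        solutions \<tau> = {Upair 1 1}) \<and>
     (4 < \<tau> \<and> \<tau> \<le> 6 \<longrightarrow>
        solutions \<tau> = {Upair 1 1, Upair (a3 \<tau>) (b3 \<tau>)} \<and>
        card (solutions \<tau>) = 2) \<and>
     (6 < \<tau> \<and> \<tau> < 2 + 2 * sqrt 5 \<longrightarrow>
        solutions \<tau> = {Upair 1 1, Upair (a1 \<tau>) (a1 \<tau>), Upair (a2 \<tau>) (a2 \<tau>),
                       Upair (a3 \<tau>) (b3 \<tau>)} \<and>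
        card (solutions \<tau>) = 4) \<and>
     (\<tau> \<ge> 2 + 2 * sqrt 5 \<longrightarrow>
        solutions \<tau> = {Upair 1 1, Upair (a1 \<tau>) (a1 \<tau>), Upair (a2 \<tau>) (a2 \<tau>),
                       Upair (a3 \<tau>) (b3 \<tau>), Upair (a5 \<tau>) (b5 \<tau>)} \<and>
        (\<tau> > 2 + 2 * sqrt 5 \<longrightarrow> card (solutions \<tau>) = 5) \<and>
        (\<tau> = 2 + 2 * sqrt 5 \<longrightarrow>
           Upair (a5 \<tau>) (b5 \<tau>) = Upair (a1 \<tau>) (a1 \<tau>) \<and> card (solutions \<tau>) = 4))"
proof -
  have t2: "\<tau> > 2" using assms cosh_real_strict_mono[of 0 \<beta>] by simp
  define s where "s = sqrt (\<tau>\<^sup>2 - 4 * \<tau>)"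
  have s2: "s\<^sup>2 = \<tau>\<^sup>2 - 4 * \<tau>" and s0: "s \<ge> 0" if "\<tau> \<ge> 4"
    using that by (auto simp: s_def power2_eq_square)
  have spos: "s > 0" if "\<tau> > 4" using that by (auto simp: s_def power2_eq_square)
  have neg: "(- s)\<^sup>2 = \<tau>\<^sup>2 - 4 * \<tau>" if "\<tau> \<ge> 4" using s2[OF that] by simp
  \<comment> \<open>Translates the threshold into \<open>s\<close>: as
    \<open>(2 * sqrt 5)\<^sup>2 = 4\<^sup>2 + 4\<close>, \<tau> = 2 + 2 sqrt 5 corresponds to
    \<open>s = 4\<close>, where the radicand \<open>s\<^sup>2 - 4 * s\<close> of \<open>a5\<close>
    changes sign.\<close>
  have cut: "(\<tau> - 2)\<^sup>2 = s\<^sup>2 + 4" if "\<tau> \<ge> 4" using s2[OF that] by (simp add: power2_diff)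
  \<comment> \<open>Puts the threshold 2 + 2 sqrt 5 above 6.\<close>
  have sqrt5: "(2::real) < sqrt 5" by (rule real_less_rsqrt) simp
  have sq_less: "x < y \<longleftrightarrow> x\<^sup>2 < y\<^sup>2" if "x \<ge> 0" "y \<ge> 0" for x y :: real
    using that by (simp flip: linorder_not_le)
  have s_lt: "\<tau> < 2 + 2 * sqrt 5 \<longleftrightarrow> s < 4" and s_gt: "\<tau> > 2 + 2 * sqrt 5 \<longleftrightarrow> s > 4"
    if "\<tau> \<ge> 4"
  proof -
    have "(\<tau> - 2)\<^sup>2 = s\<^sup>2 + 4" "(2 * sqrt 5)\<^sup>2 = (20::real)"
      using cut[OF that] by (simp_all add: power_mult_distrib)
    then show "\<tau> < 2 + 2 * sqrt 5 \<longleftrightarrow> s < 4" "\<tau> > 2 + 2 * sqrt 5 \<longleftrightarrow> s > 4"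
      using sq_less[of "\<tau> - 2" "2 * sqrt 5"] sq_less[of "2 * sqrt 5" "\<tau> - 2"]
        sq_less[of s 4] sq_less[of 4 s] s0[OF that] that by auto
  qed
  have plus: "branch_pairs \<tau> s = {Upair (a3 \<tau>) (b3 \<tau>)}"
    and sum3: "a3 \<tau> + b3 \<tau> = 2 * \<tau> / (\<tau> - s)" if "\<tau> \<ge> 4"
    using branch_pairs_singleton[of \<tau> s] s2[OF that] s0[OF that] t2
    by (simp_all add: a3_def b3_def s_def)
  have minus: "branch_pairs \<tau> (- s) = {Upair (a5 \<tau>) (b5 \<tau>)}"
    and sum5: "a5 \<tau> + b5 \<tau> = 2 * \<tau> / (\<tau> + s)" if "\<tau> \<ge> 4" "s \<ge> 4"
  proof -
    have "s * s \<ge> 4 * s" using that by (intro mult_right_mono) auto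
    then show "branch_pairs \<tau> (- s) = {Upair (a5 \<tau>) (b5 \<tau>)}" "a5 \<tau> + b5 \<tau> = 2 * \<tau> / (\<tau> + s)"
      using branch_pairs_singleton[of \<tau> "- s"] neg[OF that(1)] t2
      by (simp_all add: a5_def b5_def s_def power2_eq_square)
  qed
  \<comment> \<open>The lower bound on \<tau> is strict because \<open>s = 0\<close> at \<tau> = 4,
    where \<open>s\<^sup>2 - 4 * s\<close> is zero rather than negative.\<close>
  have minus_empty: "branch_pairs \<tau> (- s) = {}" if "\<tau> > 4" "s < 4"
  proof -
    have "s * s < 4 * s" using that spos by (intro mult_strict_right_mono) auto
    then show ?thesis
      using branch_pairs_empty[of \<tau> "- s"] neg that t2 by (simp add: power2_eq_square)
  qed
  \<comment> \<open>A positive radicand separates the two components, so this pair differs from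
    every diagonal one.\<close>
  have ne3: "a3 \<tau> \<noteq> b3 \<tau>" if "\<tau> > 4"
  proof -
    have "s\<^sup>2 + 4 * s > 0" using spos[OF that] by (simp add: pos_add_strict)
    then have "sqrt (\<tau>\<^sup>2 - 4 * \<tau> + 4 * s) > 0" using s2 that by simp
    moreover have "s < \<tau>" using branch_less[of \<tau> s] s2 that by simp
    ultimately show ?thesis by (simp add: a3_def b3_def flip: s_def)
  qed
  have ne5: "a5 \<tau> \<noteq> b5 \<tau>" if "\<tau> > 4" "s > 4"
  proof -
    have "s * s > 4 * s" using that by (intro mult_strict_right_mono) auto
    then have "s\<^sup>2 > 4 * s" by (simp add: power2_eq_square)
    then have "sqrt (\<tau>\<^sup>2 - 4 * \<tau> - 4 * s) > 0" using s2 that by simp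
    moreover have "0 < \<tau> + s" using that by simp
    ultimately show ?thesis by (simp add: a5_def b5_def flip: s_def)
  qed
  \<comment> \<open>The two pairs have different sums because \<open>s > 0\<close>.\<close>
  have ne35: "Upair (a3 \<tau>) (b3 \<tau>) \<noteq> Upair (a5 \<tau>) (b5 \<tau>)" if "\<tau> > 4" "s \<ge> 4"
  proof -
    have "s < \<tau>" using branch_less[of \<tau> s] s2 that by simp
    then have "2 * \<tau> / (\<tau> - s) \<noteq> 2 * \<tau> / (\<tau> + s)" using that by (simp add: field_simps)
    then show ?thesis using sum3 sum5 that unfolding Upair_eq_iff_sum_prod by simp
  qed
  \<comment> \<open>At the threshold \<open>s = 4\<close>, so the radicand of \<open>a5\<close> and
    \<open>b5\<close> vanishes and the pair lands on the diagonal. It meets \<open>a1\<close> there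
    because \<open>\<tau>\<^sup>2 - 16 = 4 * \<tau>\<close>.\<close>
  have edge: "Upair (a5 \<tau>) (b5 \<tau>) = Upair (a1 \<tau>) (a1 \<tau>)" if "\<tau> = 2 + 2 * sqrt 5"
  proof -
    have "\<tau> > 6" using that sqrt5 by simp
    then have "s = 4" using s_lt s_gt that by fastforce
    have "\<tau>\<^sup>2 - 4 * \<tau> = 16" using s2 \<open>s = 4\<close> \<open>\<tau> > 6\<close> by simp
    then have v5: "a5 \<tau> = \<tau> / (\<tau> + 4)" "b5 \<tau> = \<tau> / (\<tau> + 4)" by (simp_all add: a5_def b5_def)
    have "(\<tau> - 2)\<^sup>2 - 16 = 2\<^sup>2" using cut \<open>s = 4\<close> \<open>\<tau> > 6\<close> by simp
    then have v1: "a1 \<tau> = (\<tau> - 4) / 4" by (simp add: a1_def)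
    have "\<tau> / (\<tau> + 4) = (\<tau> - 4) / 4"
      using \<open>\<tau>\<^sup>2 - 4 * \<tau> = 16\<close> \<open>\<tau> > 6\<close> by (simp add: field_simps power2_eq_square)
    with v1 v5 show ?thesis by simp
  qed
  have case1: "solutions \<tau> = {Upair 1 1}" if "\<tau> \<le> 4"
  proof (cases "\<tau> = 4")
    case True
    \<comment> \<open>Both branches collapse to \<open>t = 0\<close> and contain only the pair (1,
      1), which is already on the diagonal.\<close>
    then have "s = 0" by (simp add: s_def)
    moreover have "a3 \<tau> = 1" "b3 \<tau> = 1" using True by (simp_all add: a3_def b3_def)
    ultimately show ?thesis
      using solutions_ge_4[of \<tau>] diagonal_pairs_le_6[of \<tau>] plus True by (simp add: insert_commute flip: s_def)
  next
    case False
    then show ?thesis using that t2 solutions_lt_4 diagonal_pairs_le_6 by simp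
  qed
  have case2: "solutions \<tau> = {Upair 1 1, Upair (a3 \<tau>) (b3 \<tau>)} \<and> card (solutions \<tau>) = 2"
    if "4 < \<tau>" "\<tau> \<le> 6"
  proof -
    have "s < 4" using s_lt that sqrt5 by simp
    then have "solutions \<tau> = {Upair 1 1, Upair (a3 \<tau>) (b3 \<tau>)}"
      using solutions_ge_4[of \<tau>] diagonal_pairs_le_6[of \<tau>] plus minus_empty that
      by (simp add: insert_commute flip: s_def)
    with ne3 that show ?thesis by auto
  qed
  have case3: "solutions \<tau> = {Upair 1 1, Upair (a1 \<tau>) (a1 \<tau>), Upair (a2 \<tau>) (a2 \<tau>),
      Upair (a3 \<tau>) (b3 \<tau>)} \<and> card (solutions \<tau>) = 4"
    if "6 < \<tau>" "\<tau> < 2 + 2 * sqrt 5"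
  proof -
    have "s < 4" using s_lt that by simp
    then have "solutions \<tau> = {Upair 1 1, Upair (a1 \<tau>) (a1 \<tau>), Upair (a2 \<tau>) (a2 \<tau>),
        Upair (a3 \<tau>) (b3 \<tau>)}"
      using solutions_ge_4[of \<tau>] diagonal_pairs_gt_6[of \<tau>] plus minus_empty that
      by (simp add: insert_commute flip: s_def)
    with ne3 that a1_a2[of \<tau>] show ?thesis by auto
  qed
  have case4: "solutions \<tau> = {Upair 1 1, Upair (a1 \<tau>) (a1 \<tau>), Upair (a2 \<tau>) (a2 \<tau>),
      Upair (a3 \<tau>) (b3 \<tau>), Upair (a5 \<tau>) (b5 \<tau>)}"
    and card5: "\<tau> > 2 + 2 * sqrt 5 \<Longrightarrow> card (solutions \<tau>) = 5"
    and card4: "\<tau> = 2 + 2 * sqrt 5 \<Longrightarrow> card (solutions \<tau>) = 4"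
    if ge: "\<tau> \<ge> 2 + 2 * sqrt 5"
  proof -
    have t6: "\<tau> > 6" using ge sqrt5 by simp
    then have "s \<ge> 4" using s_lt ge by fastforce
    show eq: "solutions \<tau> = {Upair 1 1, Upair (a1 \<tau>) (a1 \<tau>), Upair (a2 \<tau>) (a2 \<tau>),
        Upair (a3 \<tau>) (b3 \<tau>), Upair (a5 \<tau>) (b5 \<tau>)}"
      using solutions_ge_4[of \<tau>] diagonal_pairs_gt_6[of \<tau>] plus minus \<open>s \<ge> 4\<close> t6
      by (simp add: insert_commute flip: s_def)
    show "card (solutions \<tau>) = 5" if "\<tau> > 2 + 2 * sqrt 5"
    proof -
      have "s > 4" using s_gt that t6 by simp
      then show ?thesis
        unfolding eq using ne3 ne5 ne35 t6 a1_a2[of \<tau>] by (simp add: card_insert_if)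
    qed
    \<comment> \<open>The five listed expressions denote only four distinct pairs here, since the
      \<open>a5\<close> pair is the \<open>a1\<close> pair.\<close>
    show "card (solutions \<tau>) = 4" if "\<tau> = 2 + 2 * sqrt 5"
      unfolding eq edge[OF that] using ne3 t6 a1_a2[of \<tau>] by (auto simp: card_insert_if)
  qed
  show ?thesis using case1 case2 case3 case4 card5 card4 edge by blast
qed

end
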